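(* Let $(\lambda_n)_{n\ge 1}$ be a real sequence with $0<\lambda_1<\lambda_2<\cdots$, $\lambda_n\to+\infty$ and $\sum_{n\ge1}\frac1{\lambda_n}=\infty$. Assume that there are constants $\beta_0\ge0$, $\beta_1>0$, $c>0$ and $d>0$ so that $$\lambda_{i+1}-\lambda_i\ge\frac{d}{(i+1)^{\beta_0}}\quad\text{and}\quad\lambda_i\le c\,i^{\beta_1},\qquad i\ge1.$$ Let $\theta>0$ and $m>0$. Then there exists a constant $C>0$, that can depend only on $(\lambda_n)$ and $m$, so that, for any $a\in\ell^{1,\theta}$ with $\|a\|_{\ell^{1,\theta}}\le m$, $$\|a\|_{\ell^1}\le C\left(\left|\ln\left|\ln\left(m^{-1}\|F_a\|_\infty\right)\right|\right|^{-\theta/2}+\|F_a\|_\infty\right).$$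
   Context: Sequences $a=(a_n)_{n\ge1}$ are complex-valued; $\ell^1$ is the usual space of summable complex sequences with its usual norm. For $a\in\ell^1$, $F_a(s)=\sum_{n\ge1}a_ne^{-\lambda_ns}$, $s\ge0$, and $\|F_a\|_\infty=\sup\{|F_a(s)|:\ s\in[0,+\infty)\}$. For $\theta>0$, $\ell^{1,\theta}=\{a=(a_i):\ \sum_{i\ge1}i^\theta|a_i|<\infty\}$ with norm $\|a\|_{\ell^{1,\theta}}=\sum_{i\ge1}i^\theta|a_i|$. Convention: $\left|\ln|\ln x|\right|^{-\theta/2}$ is read as $0$ when $x=0$ or $x=1$, and as $+\infty$ when $|\ln x|=1$.
   Formalization: The constant C is allowed to depend on θ as well as on (λ_n) and m; a C independent of θ is impossible, as one sees by taking a = N^{-θ}α with α supported on {1,…,N}, ‖α‖_{ℓ^1} = m, ‖F_α‖_∞ small (Müntz), and letting θ → ∞. *)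

theory Defs
  imports "HOL-Analysis.Analysis"
begin

text \<open>Sequences \<open>(a\<^sub>n)\<close>, \<open>n \<ge> 1\<close>, are functions on \<open>nat\<close> of which only the values on \<open>{1..}\<close>
  are ever used; the value at \<open>0\<close> is irrelevant.\<close>

definition l1_norm :: "(nat \<Rightarrow> complex) \<Rightarrow> real" where
  "l1_norm a = (\<Sum>\<^sub>\<infinity>i\<in>{1..}. norm (a i))"

definition weighted_l1 :: "real \<Rightarrow> (nat \<Rightarrow> complex) set" where
  "weighted_l1 \<theta> = {a. (\<lambda>i. real i powr \<theta> * norm (a i)) summable_on {1..}}"

definition weighted_l1_norm :: "real \<Rightarrow> (nat \<Rightarrow> complex) \<Rightarrow> real" where
  "weighted_l1_norm \<theta> a = (\<Sum>\<^sub>\<infinity>i\<in>{1..}. real i powr \<theta> * norm (a i))"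

definition dirichlet_sum :: "(nat \<Rightarrow> real) \<Rightarrow> (nat \<Rightarrow> complex) \<Rightarrow> real \<Rightarrow> complex" where
  "dirichlet_sum lam a s = (\<Sum>\<^sub>\<infinity>n\<in>{1..}. a n * complex_of_real (exp (- (lam n * s))))"

text \<open>The supremum is over a bounded set whenever \<open>a\<close> is absolutely summable and \<open>lam\<close> is
  nonnegative on \<open>{1..}\<close>, so the real-valued \<open>Sup\<close> is the intended one.\<close>

definition sup_norm_halfline :: "(real \<Rightarrow> complex) \<Rightarrow> real" where
  "sup_norm_halfline F = (SUP s\<in>{0..}. norm (F s))"

text \<open>\<open>\<bar>ln \<bar>ln x\<bar>\<bar>\<close> to the power \<open>- \<theta> / 2\<close> for \<open>x \<ge> 0\<close>, extended by its limit values: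
  \<open>0\<close> at \<open>x = 0\<close> and \<open>x = 1\<close>, and \<open>+\<infinity>\<close> where \<open>\<bar>ln x\<bar> = 1\<close>. The case distinction
  is needed because \<open>ln 0 = 0\<close> and \<open>0 powr p = 0\<close> in the library.\<close>

definition loglog_power :: "real \<Rightarrow> real \<Rightarrow> ereal" where
  "loglog_power \<theta> x =
    (if x = 0 \<or> x = 1 then 0
     else if \<bar>ln x\<bar> = 1 then \<infinity>
     else ereal (\<bar>ln \<bar>ln x\<bar>\<bar> powr (- \<theta> / 2)))"

end

theory Submission
  imports Defs "HOL-Real_Asymp.Real_Asymp"
begin

text \<open>The coefficients are recovered one after the other. If the tail
  \<open>\<Sum>\<^bsub>n>k\<^esub> a\<^sub>n e\<^bsup>-\<lambda>\<^sub>n s\<^esup>\<close> is bounded by \<open>m y\<close> on the half-line, then evaluating it at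
  \<open>s = ln (1/y) / \<lambda>\<^bsub>k+2\<^esub>\<close> gives \<open>\<bar>a\<^bsub>k+1\<^esub>\<bar> \<le> 2 m y\<^bsup>\<kappa>\<^esup>\<close> with
  \<open>\<kappa> = 1 - \<lambda>\<^bsub>k+1\<^esub> / \<lambda>\<^bsub>k+2\<^esub>\<close>, and the next tail is bounded by \<open>3 m y\<^bsup>\<kappa>\<^esup>\<close>. The gap and growth
  conditions keep the product of the first \<open>n\<close> exponents \<open>\<kappa>\<close> above \<open>exp (- b n\<^sup>2)\<close>, so that
  the first \<open>n\<close> coefficients are negligible as long as \<open>2 b n\<^sup>2 \<le> ln (ln (1/x))\<close>, where
  \<open>x = \<parallel>F\<^sub>a\<parallel> / m\<close>. The remaining ones sum up to at most \<open>m n\<^bsup>-\<theta>\<^esup>\<close>.\<close>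

section \<open>Tails of the series and exponents of the recovery step\<close>

definition dirichlet_tail :: "(nat \<Rightarrow> real) \<Rightarrow> (nat \<Rightarrow> complex) \<Rightarrow> nat \<Rightarrow> real \<Rightarrow> complex" where
  "dirichlet_tail lam a k s = (\<Sum>\<^sub>\<infinity>n\<in>{k<..}. a n * complex_of_real (exp (- (lam n * s))))"

text \<open>The exponent \<kappa> of the recovery step that starts with \<open>k\<close>
  coefficients already removed and isolates \<open>a (Suc k)\<close>; hence the shifted
  indices.\<close>

definition gap_ratio :: "(nat \<Rightarrow> real) \<Rightarrow> nat \<Rightarrow> real" where
  "gap_ratio lam k = 1 - lam (Suc k) / lam (Suc (Suc k))"

section \<open>Summability and the weighted norm\<close>

lemma weighted_l1_imp_summable:
  assumes "a \<in> weighted_l1 \<theta>" "\<theta> \<ge> 0"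
  shows "(\<lambda>i. norm (a i)) summable_on {1..}"
proof (rule summable_on_comparison_test)
  show "(\<lambda>i. real i powr \<theta> * norm (a i)) summable_on {1..}"
    using assms by (simp add: weighted_l1_def)
  show "norm (a i) \<le> real i powr \<theta> * norm (a i)" if "i \<in> {1..}" for i
    using that assms(2) mult_right_mono[of 1 "real i powr \<theta>" "norm (a i)"]
    by (simp add: ge_one_powr_ge_zero)
qed auto

text \<open>Every index in \<open>{n<..}\<close> is at least \<open>Suc n\<close>, so the weight can
  be traded for its smallest value there. The case \<open>n = 0\<close> compares the two full
  norms.\<close>

lemma l1_tail_le_weighted:
  assumes "a \<in> weighted_l1 \<theta>" "\<theta> \<ge> 0"
  shows "(\<Sum>\<^sub>\<infinity>i\<in>{n<..}. norm (a i)) \<le> real (Suc n) powr (-\<theta>) * weighted_l1_norm \<theta> a"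
proof -
  have sub: "{n<..} \<subseteq> {1..}" by auto
  have w: "(\<lambda>i. real i powr \<theta> * norm (a i)) summable_on {1..}"
    using assms by (simp add: weighted_l1_def)
  have ws: "(\<lambda>i. real i powr \<theta> * norm (a i)) summable_on {n<..}"
    using summable_on_subset_banach[OF w sub] .
  have s: "(\<lambda>i. norm (a i)) summable_on {n<..}"
    using summable_on_subset_banach[OF weighted_l1_imp_summable[OF assms] sub] .
  have "(\<Sum>\<^sub>\<infinity>i\<in>{n<..}. norm (a i))
      \<le> (\<Sum>\<^sub>\<infinity>i\<in>{n<..}. real (Suc n) powr (-\<theta>) * (real i powr \<theta> * norm (a i)))"
  proof (rule infsum_mono[OF s summable_on_cmult_right[OF ws]])
    fix i assume "i \<in> {n<..}"
    then have i: "real (Suc n) \<le> real i" by auto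
    have "1 = real (Suc n) powr (-\<theta>) * real (Suc n) powr \<theta>"
      by (simp flip: powr_add)
    also have "\<dots> \<le> real (Suc n) powr (-\<theta>) * real i powr \<theta>"
      using i assms(2) by (intro mult_left_mono powr_mono2) auto
    finally show "norm (a i) \<le> real (Suc n) powr (-\<theta>) * (real i powr \<theta> * norm (a i))"
      using mult_right_mono[of 1 "real (Suc n) powr (-\<theta>) * real i powr \<theta>" "norm (a i)"]
      by (simp add: mult.assoc)
  qed
  also have "\<dots> = real (Suc n) powr (-\<theta>) * (\<Sum>\<^sub>\<infinity>i\<in>{n<..}. real i powr \<theta> * norm (a i))"
    by (rule infsum_cmult_right[OF ws])
  also have "\<dots> \<le> real (Suc n) powr (-\<theta>) * weighted_l1_norm \<theta> a"
    unfolding weighted_l1_norm_def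
    by (intro mult_left_mono infsum_mono_neutral ws w) auto
  finally show ?thesis .
qed

text \<open>The simplifier writes \<open>{1..}\<close> as \<open>{Suc 0..}\<close>; this rule
  identifies the full sum with the tail for \<open>k = 0\<close>.\<close>

lemma atLeast_Suc_0_eq: "{Suc 0..} = {0<..}"
  by auto

lemma l1_norm_le_weighted:
  assumes "a \<in> weighted_l1 \<theta>" "\<theta> \<ge> 0"
  shows "l1_norm a \<le> weighted_l1_norm \<theta> a"
  using l1_tail_le_weighted[OF assms, of 0] by (simp add: l1_norm_def atLeast_Suc_0_eq)

text \<open>The head is indexed by \<open>k < n\<close> with terms \<open>a (Suc k)\<close>, the
  form in which the recovery step bounds coefficients.\<close>

lemma l1_norm_split:
  assumes "(\<lambda>i. norm (a i)) summable_on {1..}"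
  shows "l1_norm a = (\<Sum>k<n. norm (a (Suc k))) + (\<Sum>\<^sub>\<infinity>i\<in>{n<..}. norm (a i))"
proof -
  have eq: "{1..} = {1..n} \<union> {n<..}" by auto
  have "l1_norm a = (\<Sum>\<^sub>\<infinity>i\<in>{1..n}. norm (a i)) + (\<Sum>\<^sub>\<infinity>i\<in>{n<..}. norm (a i))"
    unfolding l1_norm_def eq
    by (rule infsum_Un_disjoint) (auto intro: summable_on_subset_banach[OF assms])
  then show ?thesis
    by (simp add: sum.atLeast1_atMost_eq)
qed

section \<open>Successive recovery of the coefficients\<close>

context
  fixes lam :: "nat \<Rightarrow> real" and a :: "nat \<Rightarrow> complex" and m :: real
  assumes lam_pos: "\<And>n. n \<ge> 1 \<Longrightarrow> lam n > 0"
    and lam_mono: "strict_mono_on {1..} lam"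
    and summable: "(\<lambda>i. norm (a i)) summable_on {1..}"
    and l1_le: "l1_norm a \<le> m"
begin

lemma norm_coeff_le:
  assumes "n \<ge> 1"
  shows "norm (a n) \<le> m"
proof -
  have "(\<Sum>\<^sub>\<infinity>i\<in>{n}. norm (a i)) \<le> l1_norm a"
    unfolding l1_norm_def using assms by (intro infsum_mono_neutral summable) auto
  then show ?thesis using l1_le by simp
qed

lemma m_nonneg: "m \<ge> 0"
  using norm_coeff_le[of 1] norm_ge_zero[of "a 1"] by linarith

lemma norm_dirichlet_term_le:
  assumes "s \<ge> 0" "n > k"
  shows "norm (a n * complex_of_real (exp (- (lam n * s)))) \<le> norm (a n) * exp (- (lam (Suc k) * s))"
proof -
  have "lam (Suc k) \<le> lam n"
    using lam_mono assms(2) by (simp add: strict_mono_on_leD)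
  then show ?thesis
    using assms by (auto simp: norm_mult intro!: mult_left_mono mult_right_mono)
qed

lemma dirichlet_abs_summable:
  assumes "s \<ge> 0"
  shows "(\<lambda>n. norm (a n * complex_of_real (exp (- (lam n * s))))) summable_on {k<..}"
proof (rule summable_on_comparison_test)
  show "(\<lambda>n. norm (a n) * exp (- (lam (Suc k) * s))) summable_on {k<..}"
    by (intro summable_on_cmult_left summable_on_subset_banach[OF summable]) auto
qed (use norm_dirichlet_term_le[OF assms] in auto)

text \<open>The smallest exponent in the tail is \<open>lam (Suc k)\<close>, and its exponential can
  be pulled out. This a priori decay controls the unknown later tail while a coefficient is being
  isolated.\<close>

lemma norm_dirichlet_tail_le:
  assumes "s \<ge> 0"
  shows "norm (dirichlet_tail lam a k s) \<le> m * exp (- (lam (Suc k) * s))"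
proof -
  have sum: "(\<lambda>n. norm (a n)) summable_on {k<..}"
    by (rule summable_on_subset_banach[OF summable]) auto
  have "norm (dirichlet_tail lam a k s)
      \<le> (\<Sum>\<^sub>\<infinity>n\<in>{k<..}. norm (a n * complex_of_real (exp (- (lam n * s)))))"
    unfolding dirichlet_tail_def by (rule norm_infsum_bound[OF dirichlet_abs_summable[OF assms]])
  also have "\<dots> \<le> (\<Sum>\<^sub>\<infinity>n\<in>{k<..}. norm (a n) * exp (- (lam (Suc k) * s)))"
    using norm_dirichlet_term_le[OF assms]
    by (intro infsum_mono dirichlet_abs_summable[OF assms] summable_on_cmult_left[OF sum]) auto
  also have "\<dots> = (\<Sum>\<^sub>\<infinity>n\<in>{k<..}. norm (a n)) * exp (- (lam (Suc k) * s))"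
    by (rule infsum_cmult_left[OF sum])
  also have "(\<Sum>\<^sub>\<infinity>n\<in>{k<..}. norm (a n)) \<le> l1_norm a"
    unfolding l1_norm_def by (intro infsum_mono_neutral summable sum) auto
  finally show ?thesis
    using l1_le by (meson exp_ge_zero mult_right_mono order_trans)
qed

lemma norm_dirichlet_tail_le': "s \<ge> 0 \<Longrightarrow> norm (dirichlet_tail lam a k s) \<le> m"
  using norm_dirichlet_tail_le[of s k] m_nonneg lam_pos[of "Suc k"]
    mult_left_le[of "exp (- (lam (Suc k) * s))" m]
  by (simp add: mult_nonneg_nonneg)

lemma dirichlet_tail_rec:
  assumes "s \<ge> 0"
  shows "dirichlet_tail lam a k s =
    a (Suc k) * complex_of_real (exp (- (lam (Suc k) * s))) + dirichlet_tail lam a (Suc k) s"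
proof -
  have eq: "{k<..} = insert (Suc k) {Suc k<..}" by auto
  show ?thesis
    unfolding dirichlet_tail_def eq
    by (rule infsum_insert) (auto intro!: abs_summable_summable dirichlet_abs_summable assms)
qed

lemma gap_ratio_bounds: "gap_ratio lam k > 0" "gap_ratio lam k < 1"
  using lam_pos[of "Suc k"] lam_pos[of "Suc (Suc k)"]
    strict_mono_onD[OF lam_mono, of "Suc k" "Suc (Suc k)"]
  by (auto simp: gap_ratio_def)

lemma norm_coeff_step:
  assumes y: "y > 0" and le: "\<And>s. s \<ge> 0 \<Longrightarrow> norm (dirichlet_tail lam a k s) \<le> m * y"
  shows "norm (a (Suc k)) \<le> 2 * m * y powr gap_ratio lam k"
proof (cases "y \<le> 1")
  case True
  define l1 l2 where "l1 = lam (Suc k)" and "l2 = lam (Suc (Suc k))"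
  have l: "l1 > 0" "l2 > 0" using lam_pos by (auto simp: l1_def l2_def)
  \<comment> \<open>This point makes \<open>exp (- (l2 * s))\<close> equal to \<open>y\<close>, so
    the a priori bound on the next tail balances the assumed bound \<open>m * y\<close>.\<close>
  define s where "s = - ln y / l2"
  have s: "s \<ge> 0" using y True l by (simp add: s_def divide_nonpos_pos)
  have "norm (a (Suc k)) * exp (- (l1 * s))
      = norm (dirichlet_tail lam a k s - dirichlet_tail lam a (Suc k) s)"
    using dirichlet_tail_rec[OF s, of k] by (simp add: l1_def norm_mult)
  also have "\<dots> \<le> m * y + m * exp (- (l2 * s))"
    using le[OF s] norm_dirichlet_tail_le[OF s, of "Suc k"] norm_triangle_ineq4
    unfolding l2_def by (smt (verit))
  also have "exp (- (l2 * s)) = y" using l y by (simp add: s_def)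
  \<comment> \<open>Undoing the factor \<open>exp (- (l1 * s))\<close> costs
    \<open>y powr (- l1 / l2)\<close>, which lowers the exponent of \<open>y\<close> from 1 to
    \<open>gap_ratio lam k\<close>.\<close>
  finally have "norm (a (Suc k)) * exp (- (l1 * s)) * exp (l1 * s) \<le> (2 * m * y) * exp (l1 * s)"
    by (intro mult_right_mono) auto
  then have "norm (a (Suc k)) \<le> 2 * m * (y * exp (l1 * s))"
    by (simp add: mult.assoc flip: exp_add)
  also have "y * exp (l1 * s) = exp (ln y + l1 * s)"
    using y by (simp add: exp_add)
  also have "ln y + l1 * s = gap_ratio lam k * ln y"
    using l unfolding gap_ratio_def s_def l1_def[symmetric] l2_def[symmetric]
    by (simp add: field_simps)
  finally show ?thesis using y by (simp add: powr_def)
next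
  case False
  \<comment> \<open>For \<open>y > 1\<close> the point \<open>s\<close> would be negative. The
    right-hand side is then at least \<open>m\<close>, and the trivial bound suffices.\<close>
  have "1 \<le> y powr gap_ratio lam k"
    using False gap_ratio_bounds(1)[of k] by (simp add: ge_one_powr_ge_zero)
  then have "m * 1 \<le> m * (2 * y powr gap_ratio lam k)"
    using m_nonneg by (intro mult_left_mono) auto
  then show ?thesis using norm_coeff_le[of "Suc k"] by simp
qed

lemma norm_tail_step:
  assumes y: "y > 0" and le: "\<And>s. s \<ge> 0 \<Longrightarrow> norm (dirichlet_tail lam a k s) \<le> m * y"
    and s: "s \<ge> 0"
  shows "norm (dirichlet_tail lam a (Suc k) s) \<le> m * (3 * y powr gap_ratio lam k)"
proof (cases "y \<le> 1")
  case True
  have e: "exp (- (lam (Suc k) * s)) \<le> 1"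
    using s lam_pos[of "Suc k"] by simp
  have "norm (dirichlet_tail lam a (Suc k) s)
      = norm (dirichlet_tail lam a k s - a (Suc k) * complex_of_real (exp (- (lam (Suc k) * s))))"
    using dirichlet_tail_rec[OF s, of k] by simp
  also have "\<dots> \<le> norm (dirichlet_tail lam a k s) + norm (a (Suc k)) * exp (- (lam (Suc k) * s))"
    by (rule order_trans[OF norm_triangle_ineq4]) (simp add: norm_mult)
  also have "\<dots> \<le> m * y + norm (a (Suc k)) * 1"
    by (intro add_mono le s mult_left_mono e) auto
  \<comment> \<open>As \<open>y \<le> 1\<close> and the exponent is below 1, \<open>y\<close> is at
    most its power. One share comes from the current tail and two from the removed term, hence the
    factor 3.\<close>
  also have "\<dots> \<le> m * y powr gap_ratio lam k + 2 * m * y powr gap_ratio lam k"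
    using norm_coeff_step[OF y le] m_nonneg
      powr_mono'[of "gap_ratio lam k" 1 y] gap_ratio_bounds[of k] y True
    by (intro add_mono mult_left_mono) auto
  finally show ?thesis by (simp add: algebra_simps)
next
  case False
  have "1 \<le> y powr gap_ratio lam k"
    using False gap_ratio_bounds(1)[of k] by (simp add: ge_one_powr_ge_zero)
  then have "m * 1 \<le> m * (3 * y powr gap_ratio lam k)"
    using m_nonneg by (intro mult_left_mono) auto
  then show ?thesis using norm_dirichlet_tail_le'[OF s, of "Suc k"] by simp
qed

lemma prod_gap_ratio_pos: "(\<Prod>j<k. gap_ratio lam j) > 0"
  by (intro prod_pos) (use gap_ratio_bounds in auto)

text \<open>A power with exponent below 1 does not enlarge \<open>3 ^ k\<close>. Thus the constants
  of the iteration grow only geometrically while the exponents multiply.\<close>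

lemma three_pow_powr_le:
  assumes x: "x > 0"
  shows "(3 ^ k * x powr (\<Prod>j<k. gap_ratio lam j)) powr gap_ratio lam k
    \<le> 3 ^ k * x powr (\<Prod>j<Suc k. gap_ratio lam j)"
proof -
  have "((3::real) ^ k) powr gap_ratio lam k \<le> (3 ^ k) powr 1"
    using gap_ratio_bounds(2)[of k] by (intro powr_mono) auto
  then show ?thesis
    using x by (auto simp: powr_mult powr_powr intro!: mult_right_mono)
qed

lemma norm_dirichlet_tail_iterated:
  assumes x: "x > 0" and le: "\<And>s. s \<ge> 0 \<Longrightarrow> norm (dirichlet_tail lam a 0 s) \<le> m * x"
    and s: "s \<ge> 0"
  shows "norm (dirichlet_tail lam a k s) \<le> m * (3 ^ k * x powr (\<Prod>j<k. gap_ratio lam j))"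
  using s
proof (induction k arbitrary: s)
  case 0
  then show ?case using le x by simp
next
  case (Suc k)
  have "norm (dirichlet_tail lam a (Suc k) s)
      \<le> m * (3 * (3 ^ k * x powr (\<Prod>j<k. gap_ratio lam j)) powr gap_ratio lam k)"
    using x by (intro norm_tail_step Suc) auto
  also have "\<dots> \<le> m * (3 * (3 ^ k * x powr (\<Prod>j<Suc k. gap_ratio lam j)))"
    using m_nonneg by (intro mult_left_mono three_pow_powr_le x) auto
  finally show ?case by (simp only: power_Suc mult.assoc)
qed

text \<open>Partial products of numbers in (0,1) decrease, and \<open>x \<le> 1\<close> turns a
  smaller exponent into a larger power. So the bound with all \<open>n\<close> factors serves the
  first \<open>n\<close> coefficients at once.\<close>

lemma norm_coeff_iterated:
  assumes x: "0 < x" "x \<le> 1" and le: "\<And>s. s \<ge> 0 \<Longrightarrow> norm (dirichlet_tail lam a 0 s) \<le> m * x"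
    and k: "k < n" and u: "u \<le> (\<Prod>j<n. gap_ratio lam j)"
  shows "norm (a (Suc k)) \<le> 2 * m * (3 ^ n * x powr u)"
proof -
  have "norm (a (Suc k))
      \<le> 2 * m * (3 ^ k * x powr (\<Prod>j<k. gap_ratio lam j)) powr gap_ratio lam k"
    using x by (intro norm_coeff_step norm_dirichlet_tail_iterated le) auto
  also have "\<dots> \<le> 2 * m * (3 ^ k * x powr (\<Prod>j<Suc k. gap_ratio lam j))"
    using m_nonneg by (intro mult_left_mono three_pow_powr_le x) auto
  also have "\<dots> \<le> 2 * m * (3 ^ n * x powr u)"
  proof (intro mult_left_mono mult_mono)
    have "(\<Prod>j<n. gap_ratio lam j) \<le> (\<Prod>j<Suc k. gap_ratio lam j)"
    proof (rule lift_Suc_antimono_le[of "\<lambda>k. \<Prod>j<k. gap_ratio lam j"])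
      show "(\<Prod>j<Suc i. gap_ratio lam j) \<le> (\<Prod>j<i. gap_ratio lam j)" for i
        using mult_left_le[of "gap_ratio lam i" "\<Prod>j<i. gap_ratio lam j"]
          prod_gap_ratio_pos[of i] gap_ratio_bounds(2)[of i] by simp
    qed (use k in simp)
    then show "x powr (\<Prod>j<Suc k. gap_ratio lam j) \<le> x powr u"
      using u x by (intro powr_mono') auto
    show "(3::real) ^ k \<le> 3 ^ n" using k by (intro power_increasing) auto
  qed (use m_nonneg in auto)
  finally show ?thesis .
qed

end

section \<open>Lower bound for the product of the exponents\<close>

lemma prod_gap_ratio_ge:
  fixes lam :: "nat \<Rightarrow> real"
  assumes pos: "\<And>n. n \<ge> 1 \<Longrightarrow> lam n > 0"
    and b0: "\<beta>0 \<ge> 0" and b1: "\<beta>1 > 0" and c: "c > 0" and d: "d > 0"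
    and gap: "\<And>i. i \<ge> 1 \<Longrightarrow> lam (i + 1) - lam i \<ge> d / real (i + 1) powr \<beta>0"
    and growth: "\<And>i. i \<ge> 1 \<Longrightarrow> lam i \<le> c * real i powr \<beta>1"
  obtains b where "b > 0" "\<And>n. exp (- b * (real n)\<^sup>2) \<le> (\<Prod>j<n. gap_ratio lam j)"
proof
  \<comment> \<open>The gap and growth conditions bound \<open>gap_ratio lam j\<close> below by
    \<open>d / c\<close> times \<open>r powr - (\<beta>0 + \<beta>1)\<close>, where
    \<open>r = j + 2\<close>. The absolute value covers either sign of
    \<open>ln (c / d)\<close>.\<close>
  define b where "b = \<beta>0 + \<beta>1 + \<bar>ln (c / d)\<bar>"
  show "b > 0" using b0 b1 by (simp add: b_def)
  fix n :: nat
  \<comment> \<open>A bound common to all \<open>j < n\<close> makes the product an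
    \<open>n\<close>-th power. Estimating \<open>ln r\<close> by \<open>n\<close> produces the
    square in the exponent, and thereby the power \<open>- \<theta> / 2\<close> of the
    theorem.\<close>
  have "exp (- b * real n) \<le> gap_ratio lam j" if "j < n" for j
  proof -
    define r where "r = real (Suc (Suc j))"
    have r: "r > 0" by (simp add: r_def)
    have l: "lam (Suc (Suc j)) > 0" using pos by simp
    have "ln r \<le> r - 1" using r by (rule ln_le_minus_one)
    also have "\<dots> \<le> real n" using that by (simp add: r_def)
    finally have "(\<beta>0 + \<beta>1) * ln r \<le> (\<beta>0 + \<beta>1) * real n"
      using b0 b1 by (intro mult_left_mono) auto
    moreover have "ln (c / d) \<le> \<bar>ln (c / d)\<bar> * real n"
      using that mult_left_mono[of 1 "real n" "\<bar>ln (c / d)\<bar>"] by auto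
    ultimately have "- b * real n \<le> - ln (c / d) - (\<beta>0 + \<beta>1) * ln r"
      by (simp add: b_def algebra_simps)
    then have "exp (- b * real n) \<le> exp (- ln (c / d) - (\<beta>0 + \<beta>1) * ln r)" by simp
    also have "\<dots> = (d / r powr \<beta>0) / (c * r powr \<beta>1)"
      using r c d by (simp add: exp_diff exp_minus powr_def algebra_simps exp_add divide_simps)
    also have "\<dots> \<le> (d / r powr \<beta>0) / lam (Suc (Suc j))"
      using growth[of "Suc (Suc j)"] l d r by (intro divide_left_mono) (auto simp: r_def)
    also have "\<dots> \<le> (lam (Suc (Suc j)) - lam (Suc j)) / lam (Suc (Suc j))"
      using gap[of "Suc j"] l by (intro divide_right_mono) (auto simp: r_def)
    also have "\<dots> = gap_ratio lam j"
      using l by (simp add: gap_ratio_def diff_divide_distrib)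
    finally show ?thesis .
  qed
  then have "(\<Prod>j<n. exp (- b * real n)) \<le> (\<Prod>j<n. gap_ratio lam j)"
    by (intro prod_mono) auto
  then show "exp (- b * (real n)\<^sup>2) \<le> (\<Prod>j<n. gap_ratio lam j)"
    by (simp add: exp_of_nat_mult[symmetric] power2_eq_square algebra_simps)
qed

section \<open>The cut-off index and the estimate for small x\<close>

lemma l1_norm_le_loglog:
  assumes pos: "\<And>n. n \<ge> 1 \<Longrightarrow> lam n > 0" and mono: "strict_mono_on {1..} lam"
    and \<theta>: "\<theta> > 0" and b: "b > 0"
    and prod_ge: "\<And>n. exp (- b * (real n)\<^sup>2) \<le> (\<Prod>j<n. gap_ratio lam j)"
    and a: "a \<in> weighted_l1 \<theta>" and wm: "weighted_l1_norm \<theta> a \<le> m"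
    and x: "0 < x" "x < 1"
    and le: "\<And>s. s \<ge> 0 \<Longrightarrow> norm (dirichlet_sum lam a s) \<le> m * x"
    and t: "t = ln (- ln x)" "t > 0"
    and small: "exp (3 * sqrt (t / (2 * b)) - exp (t / 2)) \<le> t powr (- \<theta> / 2)"
  shows "l1_norm a \<le> m * (2 + (2 * b) powr (\<theta> / 2)) * t powr (- \<theta> / 2)"
proof -
  have sum: "(\<lambda>i. norm (a i)) summable_on {1..}"
    using weighted_l1_imp_summable[OF a] \<theta> by simp
  have l1m: "l1_norm a \<le> m"
    using l1_norm_le_weighted[OF a] \<theta> wm by simp
  note ctx = pos mono sum l1m
  have m: "m \<ge> 0" using m_nonneg[OF ctx] .
  have tail0: "norm (dirichlet_tail lam a 0 s) \<le> m * x" if "s \<ge> 0" for s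
    using le[OF that] by (simp add: dirichlet_tail_def dirichlet_sum_def atLeast_Suc_0_eq)
  \<comment> \<open>The floor of \<open>r\<close> is the largest \<open>n\<close> with
    \<open>2 * b * n^2 \<le> t\<close>. Then \<open>u \<ge> exp (- t / 2)\<close>, and since
    \<open>- ln x = exp t\<close>, the power \<open>x powr u\<close> is at most
    \<open>exp (- exp (t / 2))\<close>.\<close>
  define r where "r = sqrt (t / (2 * b))"
  have r: "r > 0" "r\<^sup>2 = t / (2 * b)" using t b by (auto simp: r_def)
  define n where "n = nat \<lfloor>r\<rfloor>"
  have n: "real n \<le> r" "r \<le> real (Suc n)" using r(1) unfolding n_def by linarith+
  define u where "u = exp (- b * (real n)\<^sup>2)"
  have "b * (real n)\<^sup>2 \<le> b * r\<^sup>2"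
    using n b by (intro mult_left_mono power_mono) auto
  then have "b * (real n)\<^sup>2 \<le> t / 2" using r b by simp
  then have "exp (t / 2) \<le> exp (t - b * (real n)\<^sup>2)" by simp
  also have "\<dots> = - ln x * u"
    using x t by (simp add: u_def exp_diff exp_minus divide_inverse)
  finally have xu: "x powr u \<le> exp (- exp (t / 2))"
    using x by (simp add: powr_def mult.commute)
  \<comment> \<open>The number of coefficients and the constants together cost only an exponential
    in \<open>sqrt t\<close>, which the doubly exponential decay absorbs; this is what
    \<open>small\<close> expresses.\<close>
  have "real n * 3 ^ n \<le> exp (real n) * exp (2 * real n)"
  proof (intro mult_mono)
    show "real n \<le> exp (real n)" using exp_ge_add_one_self[of "real n"] by linarith
    have "(3::real) ^ n \<le> exp 2 ^ n" using exp_ge_add_one_self[of 2] by (intro power_mono) auto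
    then show "3 ^ n \<le> exp (2 * real n)" by (simp add: exp_of_nat2_mult)
  qed auto
  also have "\<dots> \<le> exp (3 * r)" using n by (simp flip: exp_add)
  finally have n3: "real n * 3 ^ n \<le> exp (3 * r)" .
  have "(\<Sum>k<n. norm (a (Suc k))) \<le> (\<Sum>k<n. 2 * m * (3 ^ n * x powr u))"
    using x prod_ge[of n] by (intro sum_mono norm_coeff_iterated[OF ctx] tail0) (auto simp: u_def)
  also have "\<dots> = 2 * m * ((real n * 3 ^ n) * x powr u)" by simp
  also have "\<dots> \<le> 2 * m * (exp (3 * r) * exp (- exp (t / 2)))"
    using m by (intro mult_left_mono mult_mono n3 xu) auto
  also have "exp (3 * r) * exp (- exp (t / 2)) = exp (3 * r - exp (t / 2))"
    by (simp flip: exp_add)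
  also have "2 * m * \<dots> \<le> 2 * m * t powr (- \<theta> / 2)"
    using small m by (intro mult_left_mono) (auto simp: r_def)
  finally have head: "(\<Sum>k<n. norm (a (Suc k))) \<le> 2 * m * t powr (- \<theta> / 2)" .
  have "(\<Sum>\<^sub>\<infinity>i\<in>{n<..}. norm (a i)) \<le> real (Suc n) powr (-\<theta>) * weighted_l1_norm \<theta> a"
    using a \<theta> by (intro l1_tail_le_weighted) auto
  also have "\<dots> \<le> real (Suc n) powr (-\<theta>) * m"
    by (intro mult_left_mono wm) auto
  \<comment> \<open>The tail starts at \<open>Suc n\<close>, which is at least \<open>r\<close>,
    although \<open>n\<close> itself may be smaller or even 0.\<close>
  also have "\<dots> \<le> r powr (-\<theta>) * m"
    using n r m \<theta> by (intro mult_right_mono powr_mono2') auto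
  also have "r powr (-\<theta>) = (t / (2 * b)) powr (- \<theta> / 2)"
    using t b by (simp add: r_def powr_powr flip: powr_half_sqrt)
  also have "\<dots> = (2 * b) powr (\<theta> / 2) * t powr (- \<theta> / 2)"
    using t b by (simp add: powr_divide powr_minus field_simps)
  finally have "(\<Sum>\<^sub>\<infinity>i\<in>{n<..}. norm (a i)) \<le> (2 * b) powr (\<theta> / 2) * t powr (- \<theta> / 2) * m" .
  with head show ?thesis
    unfolding l1_norm_split[OF sum, of n] by (simp add: algebra_simps)
qed

section \<open>The constant C and the three ranges of x\<close>

lemma bdd_above_dirichlet_sum:
  assumes "\<And>n. n \<ge> 1 \<Longrightarrow> lam n > 0" "strict_mono_on {1..} lam"
    and "(\<lambda>i. norm (a i)) summable_on {1..}"
  shows "bdd_above ((\<lambda>s. norm (dirichlet_sum lam a s)) ` {0..})"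
proof (rule bdd_aboveI2)
  show "norm (dirichlet_sum lam a s) \<le> l1_norm a" if "s \<in> {0..}" for s
    using norm_dirichlet_tail_le'[OF assms order_refl, of s 0] that
    by (simp add: dirichlet_tail_def dirichlet_sum_def atLeast_Suc_0_eq)
qed

lemma loglog_power_nonneg: "loglog_power \<theta> x \<ge> 0"
  by (simp add: loglog_power_def)

theorem theorem2p3:
  fixes lam :: "nat \<Rightarrow> real" and \<theta> m :: real
  assumes "0 < lam 1"
    and "strict_mono_on {1..} lam"
    and "filterlim lam at_top sequentially"
    and "\<not> (\<lambda>n. 1 / lam n) summable_on {1..}"
    and "\<exists>\<beta>0 \<beta>1 c d :: real. \<beta>0 \<ge> 0 \<and> \<beta>1 > 0 \<and> c > 0 \<and> d > 0 \<and>
           (\<forall>i\<ge>1. lam (i + 1) - lam i \<ge> d / real (i + 1) powr \<beta>0 \<and>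
                  lam i \<le> c * real i powr \<beta>1)"
    and "\<theta> > 0" and "m > 0"
  shows "\<exists>C::real. C > 0 \<and>
           (\<forall>a\<in>weighted_l1 \<theta>. weighted_l1_norm \<theta> a \<le> m \<longrightarrow>
              ereal (l1_norm a) \<le>
                ereal C * (loglog_power \<theta> (inverse m * sup_norm_halfline (dirichlet_sum lam a)) +
                           ereal (sup_norm_halfline (dirichlet_sum lam a))))"
proof -
  have pos: "lam n > 0" if "n \<ge> 1" for n
    using strict_mono_on_leD[OF assms(2), of 1 n] that assms(1) by auto
  note mono = \<open>strict_mono_on {1..} lam\<close>
  obtain b where b: "b > 0" "\<And>n. exp (- b * (real n)\<^sup>2) \<le> (\<Prod>j<n. gap_ratio lam j)"
    using assms(5) prod_gap_ratio_ge[of lam, OF pos] by metis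
  have "eventually (\<lambda>t. exp (3 * sqrt (t / (2 * b)) - exp (t / 2)) \<le> t powr (- \<theta> / 2)) at_top"
    using b(1) \<open>\<theta> > 0\<close> by real_asymp
  then obtain T0 where T0: "\<And>t. t \<ge> T0 \<Longrightarrow>
      exp (3 * sqrt (t / (2 * b)) - exp (t / 2)) \<le> t powr (- \<theta> / 2)"
    unfolding eventually_at_top_linorder by blast
  \<comment> \<open>Beyond \<open>T0\<close> the condition \<open>small\<close> holds; the maximum
    with 1 also keeps \<open>t\<close> positive.\<close>
  define T where "T = max T0 1"
  define K where "K = m * (2 + (2 * b) powr (\<theta> / 2))"
  \<comment> \<open>The threshold with \<open>ln (- ln x0) = T\<close>. Below it \<open>K\<close>
    serves as the constant; from it on, the summand \<open>1 / x0\<close> of \<open>C\<close> lets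
    the sup norm alone dominate.\<close>
  define x0 where "x0 = exp (- exp T)"
  define C where "C = K + 1 / x0"
  have K: "K > 0" using \<open>m > 0\<close> by (simp add: K_def add_pos_nonneg)
  have x0: "x0 > 0" by (simp add: x0_def)
  have C: "C > 0" using K x0 by (simp add: C_def add_pos_pos)
  have main: "l1_norm a \<le> K * t powr (- \<theta> / 2)"
    if "a \<in> weighted_l1 \<theta>" "weighted_l1_norm \<theta> a \<le> m" "t \<ge> T" "t = ln (- ln x)" "0 < x" "x < 1"
      "\<And>s. s \<ge> 0 \<Longrightarrow> norm (dirichlet_sum lam a s) \<le> m * x" for a t x
    unfolding K_def
    by (rule l1_norm_le_loglog[OF pos mono \<open>\<theta> > 0\<close> b that(1,2,5,6,7,4)])
       (use that(3) T0[of t] in \<open>auto simp: T_def\<close>)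
  show ?thesis
  proof (intro exI conjI ballI impI, rule C)
    fix a assume a: "a \<in> weighted_l1 \<theta>" "weighted_l1_norm \<theta> a \<le> m"
    define e where "e = sup_norm_halfline (dirichlet_sum lam a)"
    define x where "x = inverse m * e"
    have e: "e = m * x" using \<open>m > 0\<close> by (simp add: x_def)
    have sum: "(\<lambda>i. norm (a i)) summable_on {1..}"
      using weighted_l1_imp_summable[OF a(1)] \<open>\<theta> > 0\<close> by simp
    \<comment> \<open>Boundedness is what makes the real-valued \<open>Sup\<close> an upper bound
      here.\<close>
    have le: "norm (dirichlet_sum lam a s) \<le> m * x" if "s \<ge> 0" for s
      unfolding e[symmetric] e_def sup_norm_halfline_def
      using that by (intro cSUP_upper bdd_above_dirichlet_sum pos mono sum) auto
    have "0 \<le> m * x" using le[of 0] norm_ge_zero order_trans by blast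
    then have x_nonneg: "x \<ge> 0" using \<open>m > 0\<close> by (simp add: zero_le_mult_iff)
    have l1m: "l1_norm a \<le> m"
      using l1_norm_le_weighted[OF a(1)] \<open>\<theta> > 0\<close> a(2) by simp
    have "ereal (l1_norm a) \<le> ereal C * (loglog_power \<theta> x + ereal e)"
    proof (cases "x < x0")
      \<comment> \<open>This range contains \<open>x = 1\<close> and both points with
        \<open>\<bar>ln x\<bar> = 1\<close>; of the loglog term only its nonnegativity is
        used.\<close>
      case False
      have "l1_norm a \<le> m" by (rule l1m)
      also have "m * 1 \<le> m * (C * x)"
      proof (intro mult_left_mono)
        have "1 \<le> 1 / x0 * x" using False x0 by simp
        also have "\<dots> \<le> C * x" using K x_nonneg by (intro mult_right_mono) (auto simp: C_def)
        finally show "1 \<le> C * x" .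
      qed (use \<open>m > 0\<close> in auto)
      finally have "ereal (l1_norm a) \<le> ereal C * (0 + ereal e)"
        by (simp add: e algebra_simps)
      also have "\<dots> \<le> ereal C * (loglog_power \<theta> x + ereal e)"
        using C by (intro ereal_mult_left_mono add_right_mono loglog_power_nonneg) auto
      finally show ?thesis .
    next
      case small: True
      show ?thesis
      proof (cases "x = 0")
        case True
        \<comment> \<open>The required bound is 0 and \<open>ln x\<close> carries no information. A
          zero sup norm admits every positive value in place of \<open>x\<close>; taking
          \<open>exp (- exp t)\<close> and letting \<open>t\<close> tend to infinity forces the norm
          to vanish.\<close>
        have "l1_norm a \<le> K * t powr (- \<theta> / 2)" if "t \<ge> T" for t
          by (rule main[OF a that, of "exp (- exp t)"])
             (use le True \<open>m > 0\<close> in \<open>auto intro: order_trans\<close>)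
        then have "eventually (\<lambda>t. l1_norm a \<le> K * t powr (- \<theta> / 2)) at_top"
          unfolding eventually_at_top_linorder by blast
        moreover have "((\<lambda>t. K * t powr (- \<theta> / 2)) \<longlongrightarrow> 0) at_top"
          using \<open>\<theta> > 0\<close> by real_asymp
        ultimately have "l1_norm a \<le> 0"
          by (intro tendsto_lowerbound[of _ 0 at_top]) auto
        then show ?thesis using True by (simp add: e loglog_power_def)
      next
        case False
        with x_nonneg have x: "x > 0" by simp
        have "ln x < ln x0" using x small by simp
        then have lx: "exp T < - ln x" by (simp add: x0_def)
        moreover have "T \<ge> 1" by (simp add: T_def)
        ultimately have lx1: "- ln x > 1" using exp_ge_add_one_self[of T] by linarith
        then have x1: "x < 1" using x by (simp add: ln_less_zero_iff[symmetric] del: ln_less_zero_iff)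
        have tT: "ln (- ln x) > T"
          using lx lx1 ln_less_cancel_iff[of "exp T" "- ln x"] by simp
        have lle: "l1_norm a \<le> K * ln (- ln x) powr (- \<theta> / 2)"
          using main[OF a less_imp_le[OF tT] refl x x1 le] .
        \<comment> \<open>Here \<open>- ln x > 1\<close> and \<open>ln (- ln x) > T \<ge> 1\<close>,
          which rules out the special values and resolves both absolute values.\<close>
        have "loglog_power \<theta> x = ereal (ln (- ln x) powr (- \<theta> / 2))"
          using x x1 lx1 tT \<open>T \<ge> 1\<close> by (auto simp: loglog_power_def abs_if)
        moreover have "K * ln (- ln x) powr (- \<theta> / 2) \<le> C * (ln (- ln x) powr (- \<theta> / 2) + e)"
          using K x0 x_nonneg \<open>m > 0\<close> by (intro mult_mono) (auto simp: C_def e)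
        ultimately show ?thesis using lle by simp
      qed
    qed
    then show "ereal (l1_norm a) \<le>
        ereal C * (loglog_power \<theta> (inverse m * sup_norm_halfline (dirichlet_sum lam a)) +
                   ereal (sup_norm_halfline (dirichlet_sum lam a)))"
      by (simp add: e_def x_def)
  qed
qed

end
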